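(* If $X$ is a coverable uniform space with $u\dim X\leq n$, then $u\dim\widetilde{X}\leq n$.
   Context: A uniform open cover of a uniform space is an open cover that is refined by the cover by $F$-balls $B(x,F)=\{y:(x,y)\in F\}$ for some fixed entourage $F$. $u\dim X\leq n$ means that every uniform open cover of $X$ has a refinement by a uniform open cover of order $n+1$, i.e. one for which every point lies in at most $n+1$ of its sets. All entourages are taken to be symmetric. Fix a basepoint $*\in X$. For an entourage $E$ of $X$, an $E$-chain from $p$ to $q$ is a finite sequence $\{x_0=p,\dots,x_n=q\}$ with $(x_i,x_{i+1})\in E$ for all $i$. Two $E$-chains with the same endpoints are $E$-homotopic if one is obtained from the other in finitely many steps, each adding or removing a single point, always keeping the endpoints fixed and keeping an $E$-chain at each stage (in particular $\{p\}$ and $\{p,p\}$ are $E$-homotopic); $[\alpha]_E$ is the class of $\alpha$. $X_E$ is the set of $E$-homotopy classes of $E$-chains starting at $*$. For an entourage $D\subset E$ let $D^*$ be the set of pairs $([*=x_0,\dots,x_n,y]_E,[*=x_0,\dots,x_n,z]_E)$ with $(y,z)\in D$; $X_E$ carries the uniformity with base $\{D^*:D\subset E\}$. For $D\subset E$, $\phi_{ED}:X_D\to X_E$ is $[\alpha]_D\mapsto[\alpha]_E$. $\widetilde{X}=\varprojlim X_E$ (over all entourages, ordered by reverse inclusion, with the inverse limit uniformity), with projections $\phi_E:\widetilde{X}\to X_E$. $X$ is coverable if its uniformity has a base, containing $X\times X$, of entourages $E$ for which $\phi_E$ is surjective. *)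

theory Defs
  imports Complex_Main "HOL-Library.FuncSet"
begin

section \<open>Uniform covers and uniform dimension\<close>

text \<open>
  The inverse limit below depends on a basepoint, so it lives on a set rather than on a type.
  A uniform space is therefore given by a carrier \<open>S\<close> and a filter \<open>U\<close> on pairs, concentrated on
  \<open>S \<times> S\<close>; an \<open>'a :: uniform_space\<close> of the library is the case \<open>S = UNIV\<close>, \<open>U = uniformity\<close>.
  All entourages are symmetric by convention.
\<close>

definition entourages :: "'a set \<Rightarrow> ('a \<times> 'a) filter \<Rightarrow> ('a \<times> 'a) set set" where
  "entourages S U = {E. E \<subseteq> S \<times> S \<and> sym E \<and> eventually (\<lambda>p. p \<in> E) U}"

definition unif_open :: "'a set \<Rightarrow> ('a \<times> 'a) filter \<Rightarrow> 'a set \<Rightarrow> bool" where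
  "unif_open S U V \<longleftrightarrow>
     V \<subseteq> S \<and> (\<forall>x\<in>V. eventually (\<lambda>(x', y). x' = x \<longrightarrow> y \<in> V) U)"

lemma unif_open_UNIV: "unif_open UNIV uniformity V \<longleftrightarrow> open (V :: 'a :: uniform_space set)"
  by (simp add: unif_open_def open_uniformity)

definition refines :: "'a set set \<Rightarrow> 'a set set \<Rightarrow> bool" where
  "refines \<V> \<U> \<longleftrightarrow> (\<forall>V\<in>\<V>. \<exists>W\<in>\<U>. V \<subseteq> W)"

text \<open>The \<open>F\<close>-ball \<open>B(x, F)\<close> is \<open>F `` {x}\<close>.\<close>

definition uniform_open_cover :: "'a set \<Rightarrow> ('a \<times> 'a) filter \<Rightarrow> 'a set set \<Rightarrow> bool" where
  "uniform_open_cover S U \<U> \<longleftrightarrow>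
     (\<forall>V\<in>\<U>. unif_open S U V) \<and> \<Union>\<U> = S \<and>
     (\<exists>F\<in>entourages S U. refines {F `` {x} |x. x \<in> S} \<U>)"

definition udim_le :: "'a set \<Rightarrow> ('a \<times> 'a) filter \<Rightarrow> nat \<Rightarrow> bool" where
  "udim_le S U n \<longleftrightarrow>
     (\<forall>\<U>. uniform_open_cover S U \<U> \<longrightarrow>
        (\<exists>\<V>. uniform_open_cover S U \<V> \<and> refines \<V> \<U> \<and>
             (\<forall>x\<in>S. finite {V \<in> \<V>. x \<in> V} \<and> card {V \<in> \<V>. x \<in> V} \<le> n + 1)))"


section \<open>Chains and homotopy classes of chains\<close>

text \<open>An \<open>E\<close>-chain \<open>x\<^sub>0, \<dots>, x\<^sub>n\<close> is the nonempty list of its points.\<close>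

definition e_chain :: "('a \<times> 'a) set \<Rightarrow> 'a list \<Rightarrow> bool" where
  "e_chain E \<alpha> \<longleftrightarrow> \<alpha> \<noteq> [] \<and> successively (\<lambda>x y. (x, y) \<in> E) \<alpha>"

definition add_point :: "('a \<times> 'a) set \<Rightarrow> 'a list \<Rightarrow> 'a list \<Rightarrow> bool" where
  "add_point E \<alpha> \<beta> \<longleftrightarrow>
     e_chain E \<alpha> \<and> e_chain E \<beta> \<and> hd \<beta> = hd \<alpha> \<and> last \<beta> = last \<alpha> \<and>
     (\<exists>xs ys z. \<alpha> = xs @ ys \<and> \<beta> = xs @ z # ys)"

definition e_homotopic :: "('a \<times> 'a) set \<Rightarrow> 'a list \<Rightarrow> 'a list \<Rightarrow> bool" where
  "e_homotopic E = equivclp (add_point E)"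

definition e_class :: "('a \<times> 'a) set \<Rightarrow> 'a list \<Rightarrow> 'a list set" where
  "e_class E \<alpha> = {\<beta>. e_homotopic E \<alpha> \<beta>}"

lemma e_homotopic_mono: "D \<subseteq> E \<Longrightarrow> e_homotopic D \<alpha> \<beta> \<Longrightarrow> e_homotopic E \<alpha> \<beta>"
proof -
  assume DE: "D \<subseteq> E" and h: "e_homotopic D \<alpha> \<beta>"
  have chain: "e_chain D \<gamma> \<Longrightarrow> e_chain E \<gamma>" for \<gamma>
    unfolding e_chain_def using DE by (auto intro: successively_mono)
  have "add_point D \<gamma> \<delta> \<Longrightarrow> add_point E \<gamma> \<delta>" for \<gamma> \<delta>
    using chain unfolding add_point_def by blast
  then have "symclp (add_point D) \<le> symclp (add_point E)"
    by (auto simp: symclp_def)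
  from rtranclp_mono[OF this] show ?thesis
    using h unfolding e_homotopic_def equivclp_def by blast
qed

lemma e_class_eqI: "e_homotopic E \<alpha> \<beta> \<Longrightarrow> e_class E \<alpha> = e_class E \<beta>"
  unfolding e_class_def e_homotopic_def
  by (blast intro: equivclp_sym equivclp_trans)

lemma e_class_refl: "\<alpha> \<in> e_class E \<alpha>"
  by (simp add: e_class_def e_homotopic_def)

definition X_space :: "'a \<Rightarrow> ('a \<times> 'a) set \<Rightarrow> 'a list set set" where
  "X_space a E = {e_class E \<alpha> |\<alpha>. e_chain E \<alpha> \<and> hd \<alpha> = a}"

definition star_ent :: "'a \<Rightarrow> ('a \<times> 'a) set \<Rightarrow> ('a \<times> 'a) set \<Rightarrow> ('a list set \<times> 'a list set) set" where
  "star_ent a E D =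
     {(e_class E (xs @ [y]), e_class E (xs @ [z])) |xs y z.
        xs \<noteq> [] \<and> hd xs = a \<and> e_chain E (xs @ [y]) \<and> e_chain E (xs @ [z]) \<and> (y, z) \<in> D}"

definition X_unif ::
    "'a :: uniform_space \<Rightarrow> ('a \<times> 'a) set \<Rightarrow> ('a list set \<times> 'a list set) filter" where
  "X_unif a E = (INF D\<in>{D \<in> entourages UNIV uniformity. D \<subseteq> E}. principal (star_ent a E D))"

lemma eventually_X_unif:
  fixes a :: "'a :: uniform_space"
  assumes E: "E \<in> entourages UNIV uniformity"
  shows "eventually P (X_unif a E) \<longleftrightarrow>
           (\<exists>D\<in>entourages UNIV uniformity. D \<subseteq> E \<and> (\<forall>p\<in>star_ent a E D. P p))"
proof -
  let ?I = "{D \<in> entourages UNIV (uniformity :: ('a \<times> 'a) filter). D \<subseteq> E}"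
  have "eventually P (X_unif a E) \<longleftrightarrow>
          (\<exists>D\<in>?I. eventually P (principal (star_ent a E D)))"
    unfolding X_unif_def
  proof (rule eventually_INF_base)
    show "?I \<noteq> {}" using E by auto
    fix D D' assume "D \<in> ?I" "D' \<in> ?I"
    then have "D \<inter> D' \<in> ?I"
      by (auto simp: entourages_def sym_Int eventually_conj)
    moreover have "star_ent a E (D \<inter> D') \<subseteq> star_ent a E D \<inter> star_ent a E D'"
      unfolding star_ent_def by auto
    ultimately show "\<exists>x\<in>?I. principal (star_ent a E x) \<le>
        inf (principal (star_ent a E D)) (principal (star_ent a E D'))"
      by (auto intro!: bexI[of _ "D \<inter> D'"])
  qed
  then show ?thesis by (auto simp: eventually_principal)
qed

text \<open>The bonding map into \<open>X_space a E\<close>; its domain \<open>X_space a D\<close> is implicit.\<close>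

definition X_bond :: "('a \<times> 'a) set \<Rightarrow> 'a list set \<Rightarrow> 'a list set" where
  "X_bond E c = the_elem (e_class E ` c)"

lemma X_bond_e_class:
  assumes "D \<subseteq> E"
  shows "X_bond E (e_class D \<alpha>) = e_class E \<alpha>"
proof -
  have "e_class E \<beta> = e_class E \<alpha>" if "\<beta> \<in> e_class D \<alpha>" for \<beta>
    using that e_class_eqI[OF e_homotopic_mono[OF assms], of \<alpha> \<beta>] by (simp add: e_class_def[of D])
  then have "e_class E ` e_class D \<alpha> = {e_class E \<alpha>}"
    using e_class_refl[of \<alpha> D] by blast
  then show ?thesis by (simp add: X_bond_def)
qed


section \<open>The inverse limit and coverability\<close>

text \<open>
  Points of the limit are compatible families indexed by the entourages; the projection to
  \<open>X_space a E\<close> is evaluation at \<open>E\<close>.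
\<close>

definition X_tilde :: "'a :: uniform_space \<Rightarrow> (('a \<times> 'a) set \<Rightarrow> 'a list set) set" where
  "X_tilde a =
     {f \<in> (\<Pi>\<^sub>E E\<in>entourages UNIV uniformity. X_space a E).
        \<forall>D\<in>entourages UNIV uniformity. \<forall>E\<in>entourages UNIV uniformity.
          D \<subseteq> E \<longrightarrow> X_bond E (f D) = f E}"

definition X_tilde_proj ::
    "('a \<times> 'a) set \<Rightarrow> (('a \<times> 'a) set \<Rightarrow> 'a list set) \<Rightarrow> 'a list set" where
  "X_tilde_proj E f = f E"

definition X_tilde_unif ::
    "'a :: uniform_space \<Rightarrow>
      ((('a \<times> 'a) set \<Rightarrow> 'a list set) \<times> (('a \<times> 'a) set \<Rightarrow> 'a list set)) filter" where
  "X_tilde_unif a =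
     inf (principal (X_tilde a \<times> X_tilde a))
         (INF E\<in>entourages UNIV uniformity.
            filtercomap (map_prod (X_tilde_proj E) (X_tilde_proj E)) (X_unif a E))"

definition coverable :: "'a :: uniform_space \<Rightarrow> bool" where
  "coverable a \<longleftrightarrow>
     (\<exists>\<B> \<subseteq> entourages UNIV uniformity.
        UNIV \<in> \<B> \<and>
        (\<forall>D\<in>entourages UNIV uniformity. \<exists>E\<in>\<B>. E \<subseteq> D) \<and>
        (\<forall>E\<in>\<B>. X_tilde_proj E ` X_tilde a = X_space a E))"

end

theory Submission
  imports Defs
begin

text \<open>
  The reason is that \<open>X_space a E\<close> is a covering of \<open>X\<close>: a class with endpoint \<open>y\<close> can be
  continued to each \<open>z\<close> with \<open>(y, z) \<in> E\<close>, and the pairs \<open>(c, d)\<close> in \<open>star_ent a E D\<close> are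
  exactly those for which \<open>d\<close> is the continuation of \<open>c\<close> to a point \<open>D\<close>-close to its endpoint
  (\<open>star_ent_iff\<close>). Over an open set \<open>V\<close> with \<open>V \<times> V \<subseteq> E\<close>, continuing to a point of \<open>V\<close> and
  then to another is the same as continuing to the latter at once (\<open>extend_extend\<close>), so the part
  of \<open>X_space a E\<close> over \<open>V\<close> is a disjoint union of sheets, each a copy of \<open>V\<close>.

  The sets \<open>{(f, g). (f E, g E) \<in> star_ent a E E}\<close> form a base of the uniformity of the limit
  (\<open>eventually_X_tilde_unif\<close>), so a given uniform open cover of \<open>X_tilde a\<close> is refined by the
  balls of such a set for one entourage \<open>E\<close>. Since \<open>X\<close> has dimension at most \<open>n\<close>, it has a uniform
  open cover \<open>\<V>\<close> of order \<open>n + 1\<close> by sets \<open>V\<close> with \<open>V \<times> V \<subseteq> E\<close>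
  (\<open>uniform_open_cover_small_sets\<close>). The preimages in \<open>X_tilde a\<close> of the sheets over the members
  of \<open>\<V>\<close> form the required refinement: a sheet lies in the ball about each of its points, and a
  point lies on exactly one sheet over each \<open>V \<in> \<V>\<close> containing its endpoint, so the order does
  not increase.
\<close>

section \<open>Entourages\<close>

lemma entourage_refl:
  fixes E :: "('a :: uniform_space \<times> 'a) set"
  assumes "E \<in> entourages UNIV uniformity"
  shows "(x, x) \<in> E"
  using assms uniformity_refl[of "\<lambda>p. p \<in> E" x] by (simp add: entourages_def)

lemma entourage_sym: "E \<in> entourages S U \<Longrightarrow> (x, y) \<in> E \<Longrightarrow> (y, x) \<in> E"
  by (auto simp: entourages_def dest: symD)

lemma entourages_Int:
  "D \<in> entourages S U \<Longrightarrow> E \<in> entourages S U \<Longrightarrow> D \<inter> E \<in> entourages S U"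
  by (auto simp: entourages_def sym_Int eventually_conj)

lemma UNIV_entourage: "UNIV \<in> entourages UNIV U"
  by (simp add: entourages_def sym_def)

lemma eventually_uniformity_imp_entourage:
  assumes "eventually P (uniformity :: ('a :: uniform_space \<times> 'a) filter)"
  shows "\<exists>D\<in>entourages UNIV uniformity. \<forall>p\<in>D. P p"
proof
  let ?D = "{(x, y). P (x, y) \<and> P (y, x)}"
  have "eventually (\<lambda>p. P p \<and> (case p of (x, y) \<Rightarrow> P (y, x))) uniformity"
    using assms uniformity_sym[OF assms] by (rule eventually_conj)
  then have "eventually (\<lambda>p. p \<in> ?D) uniformity"
    by (rule eventually_mono) auto
  then show "?D \<in> entourages UNIV uniformity"
    by (auto simp: entourages_def sym_def)
qed auto

lemma entourage_half:
  fixes E :: "('a :: uniform_space \<times> 'a) set"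
  assumes "E \<in> entourages UNIV uniformity"
  obtains D where "D \<in> entourages UNIV uniformity"
    "\<And>x y z. (x, y) \<in> D \<Longrightarrow> (y, z) \<in> D \<Longrightarrow> (x, z) \<in> E"
proof -
  have "eventually (\<lambda>p. p \<in> E) uniformity"
    using assms by (simp add: entourages_def)
  from uniformity_transE[OF this] obtain P where P: "eventually P uniformity"
    "\<And>x y z. P (x, y) \<Longrightarrow> P (y, z) \<Longrightarrow> (x, z) \<in> E"
    by blast
  obtain D where "D \<in> entourages UNIV uniformity" "\<forall>p\<in>D. P p"
    using eventually_uniformity_imp_entourage[OF P(1)] by blast
  with P(2) that show ?thesis by blast
qed

lemma refines_balls_iff:
  "refines {F `` {x} |x. x \<in> S} \<U> \<longleftrightarrow> (\<forall>x\<in>S. \<exists>W\<in>\<U>. F `` {x} \<subseteq> W)"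
  unfolding refines_def by blast

text \<open>
  Balls need not be open, so the cover consists of all open \<open>E\<close>-small sets; the largest open
  subset of a \<open>D\<close>-ball is one of them, where \<open>D \<circ> D \<subseteq> E\<close>, and it contains the ball of any
  \<open>F\<close> with \<open>F \<circ> F \<subseteq> D\<close>.
\<close>

lemma uniform_open_cover_small_sets:
  fixes E :: "('a :: uniform_space \<times> 'a) set"
  assumes E: "E \<in> entourages UNIV uniformity"
  shows "uniform_open_cover UNIV uniformity {V. open V \<and> V \<times> V \<subseteq> E}"
proof -
  obtain D where D: "D \<in> entourages UNIV uniformity"
    "\<And>x y z. (x, y) \<in> D \<Longrightarrow> (y, z) \<in> D \<Longrightarrow> (x, z) \<in> E"
    using entourage_half[OF E] by blast
  obtain F where F: "F \<in> entourages UNIV uniformity"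
    "\<And>x y z. (x, y) \<in> F \<Longrightarrow> (y, z) \<in> F \<Longrightarrow> (x, z) \<in> D"
    using entourage_half[OF D(1)] by blast
  have ex: "\<exists>V\<in>{V. open V \<and> V \<times> V \<subseteq> E}. F `` {x} \<subseteq> V" for x
  proof (intro bexI CollectI conjI)
    let ?V = "\<Union>{S. open S \<and> S \<subseteq> D `` {x}}"
    show "open ?V" by auto
    have "?V \<subseteq> D `` {x}" by auto
    then show "?V \<times> ?V \<subseteq> E"
      using D(2) entourage_sym[OF D(1)] by blast
    show "F `` {x} \<subseteq> ?V"
    proof
      fix y assume y: "y \<in> F `` {x}"
      have "eventually (\<lambda>p. p \<in> F) uniformity"
        using F(1) by (simp add: entourages_def)
      then have "eventually (\<lambda>z. z \<in> D `` {x}) (nhds y)"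
        unfolding eventually_nhds_uniformity
        by (rule eventually_mono) (use y F(2) in auto)
      then show "y \<in> ?V" by (auto simp: eventually_nhds)
    qed
  qed
  then have "refines {F `` {x} |x. x \<in> UNIV} {V. open V \<and> V \<times> V \<subseteq> E}"
    unfolding refines_balls_iff by simp
  moreover have "\<Union>{V. open V \<and> V \<times> V \<subseteq> E} = UNIV"
  proof (rule UNIV_eq_I[symmetric])
    fix x
    obtain V where V: "V \<in> {V. open V \<and> V \<times> V \<subseteq> E}" "F `` {x} \<subseteq> V"
      using bexE[OF ex] by metis
    then have "x \<in> V" using entourage_refl[OF F(1)] by blast
    with V(1) show "x \<in> \<Union>{V. open V \<and> V \<times> V \<subseteq> E}" by (rule UnionI)
  qed
  ultimately show ?thesis
    using F(1) unfolding uniform_open_cover_def by (intro conjI bexI) (auto simp: unif_open_UNIV)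
qed

section \<open>Homotopic chains\<close>

lemma e_chain_append_single:
  "e_chain E \<alpha> \<Longrightarrow> e_chain E (\<alpha> @ [z]) \<longleftrightarrow> (last \<alpha>, z) \<in> E"
  by (auto simp: e_chain_def successively_append_iff)

lemma e_chain_append_singleD:
  "e_chain E (xs @ [z]) \<Longrightarrow> xs \<noteq> [] \<Longrightarrow> e_chain E xs \<and> (last xs, z) \<in> E"
  by (auto simp: e_chain_def successively_append_iff)

lemma e_homotopic_induct [consumes 1, case_names refl step]:
  assumes "e_homotopic E \<alpha> \<beta>" and "P \<alpha>"
    and "\<And>\<beta> \<gamma>. e_homotopic E \<alpha> \<beta> \<Longrightarrow> add_point E \<beta> \<gamma> \<or> add_point E \<gamma> \<beta> \<Longrightarrow> P \<beta> \<Longrightarrow> P \<gamma>"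
  shows "P \<beta>"
  using assms(1) unfolding e_homotopic_def
proof (induction rule: equivclp_induct)
  case base
  show ?case by fact
next
  case (step y z)
  then show ?case using assms(3) by (auto simp: e_homotopic_def)
qed

lemma e_homotopic_invariants:
  assumes "e_homotopic E \<alpha> \<beta>" "e_chain E \<alpha>"
  shows "e_chain E \<beta> \<and> hd \<beta> = hd \<alpha> \<and> last \<beta> = last \<alpha>"
  using assms by (induction rule: e_homotopic_induct) (auto simp: add_point_def)

lemma add_point_imp_homotopic: "add_point E \<alpha> \<beta> \<Longrightarrow> e_homotopic E \<alpha> \<beta>"
  by (simp add: e_homotopic_def r_into_equivclp)

lemma add_point_append_single:
  assumes "add_point E \<alpha> \<beta>" "(last \<alpha>, z) \<in> E"
  shows "add_point E (\<alpha> @ [z]) (\<beta> @ [z])"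
proof -
  obtain xs ys w where *: "\<alpha> = xs @ ys" "\<beta> = xs @ w # ys"
    using assms(1) by (auto simp: add_point_def)
  have ends: "e_chain E \<alpha>" "e_chain E \<beta>" "hd \<beta> = hd \<alpha>" "last \<beta> = last \<alpha>"
    using assms(1) by (auto simp: add_point_def)
  have "e_chain E (\<alpha> @ [z])" "e_chain E (\<beta> @ [z])"
    using ends assms(2) by (simp_all add: e_chain_append_single)
  moreover have "hd (\<beta> @ [z]) = hd (\<alpha> @ [z])"
    using ends by (simp add: e_chain_def)
  moreover have "\<alpha> @ [z] = xs @ (ys @ [z])" "\<beta> @ [z] = xs @ w # (ys @ [z])"
    using * by simp_all
  ultimately show ?thesis unfolding add_point_def by auto
qed

lemma e_homotopic_append_single:
  assumes "e_homotopic E \<alpha> \<beta>" "e_chain E \<alpha>" "(last \<alpha>, z) \<in> E"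
  shows "e_homotopic E (\<alpha> @ [z]) (\<beta> @ [z])"
  using assms(1)
proof (induction rule: e_homotopic_induct)
  case refl
  show ?case by (simp add: e_homotopic_def)
next
  case (step \<beta> \<gamma>)
  have "last \<beta> = last \<alpha>"
    using e_homotopic_invariants[OF step.hyps(1) assms(2)] by simp
  moreover have "last \<gamma> = last \<beta>"
    using step.hyps(2) by (auto simp: add_point_def)
  ultimately have "(last \<beta>, z) \<in> E" "(last \<gamma>, z) \<in> E" using assms(3) by auto
  with step.hyps(2) have "e_homotopic E (\<beta> @ [z]) (\<gamma> @ [z])"
    using add_point_append_single add_point_imp_homotopic
    by (metis e_homotopic_def equivclp_sym)
  with step.IH show ?case
    unfolding e_homotopic_def by (blast intro: equivclp_trans)
qed

lemma e_class_drop_middle: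
  assumes "e_chain E \<alpha>" "(last \<alpha>, z) \<in> E" "(z, w) \<in> E" "(last \<alpha>, w) \<in> E"
  shows "e_class E (\<alpha> @ [z, w]) = e_class E (\<alpha> @ [w])"
proof -
  have "e_chain E (\<alpha> @ [w])" "e_chain E (\<alpha> @ [z, w])"
    using assms by (auto simp: e_chain_def successively_append_iff)
  then have "add_point E (\<alpha> @ [w]) (\<alpha> @ [z, w])"
    using assms(1) by (auto simp: add_point_def e_chain_def)
  then show ?thesis
    by (metis add_point_imp_homotopic e_class_eqI)
qed

lemma e_class_repeat_last:
  assumes "e_chain E \<alpha>" "(last \<alpha>, last \<alpha>) \<in> E"
  shows "e_class E (\<alpha> @ [last \<alpha>]) = e_class E \<alpha>"
proof -
  have "e_chain E (\<alpha> @ [last \<alpha>])"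
    using assms by (simp add: e_chain_append_single)
  moreover have "\<alpha> = \<alpha> @ []" by simp
  ultimately have "add_point E \<alpha> (\<alpha> @ [last \<alpha>])"
    using assms(1) unfolding add_point_def by (auto simp: e_chain_def)
  then show ?thesis
    by (metis add_point_imp_homotopic e_class_eqI)
qed

section \<open>The covering of the space by homotopy classes of chains\<close>

text \<open>
  Both functions choose a representative. All representatives of the class of an \<open>E\<close>-chain have
  the same last point, and continuing them by an \<open>E\<close>-small step keeps them homotopic, so nothing
  depends on the choice (\<open>endpoint_e_class\<close>, \<open>extend_e_class\<close>).
\<close>

definition endpoint :: "'a list set \<Rightarrow> 'a" where
  "endpoint c = last (SOME \<alpha>. \<alpha> \<in> c)"

definition extend :: "('a \<times> 'a) set \<Rightarrow> 'a list set \<Rightarrow> 'a \<Rightarrow> 'a list set" where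
  "extend E c z = e_class E ((SOME \<alpha>. \<alpha> \<in> c) @ [z])"

lemma some_in_e_class: "e_homotopic E \<alpha> (SOME \<beta>. \<beta> \<in> e_class E \<alpha>)"
  using someI[of "\<lambda>\<beta>. \<beta> \<in> e_class E \<alpha>", OF e_class_refl] by (simp add: e_class_def)

lemma endpoint_e_class: "e_chain E \<alpha> \<Longrightarrow> endpoint (e_class E \<alpha>) = last \<alpha>"
  unfolding endpoint_def using e_homotopic_invariants[OF some_in_e_class] by blast

lemma extend_e_class:
  assumes "e_chain E \<alpha>" "(last \<alpha>, z) \<in> E"
  shows "extend E (e_class E \<alpha>) z = e_class E (\<alpha> @ [z])"
  unfolding extend_def
  using e_class_eqI[OF e_homotopic_append_single[OF some_in_e_class assms]] by simp

lemma X_spaceE: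
  assumes "c \<in> X_space a E"
  obtains \<alpha> where "c = e_class E \<alpha>" "e_chain E \<alpha>" "hd \<alpha> = a" "endpoint c = last \<alpha>"
  using assms by (auto simp: X_space_def endpoint_e_class)

lemma endpoint_extend:
  assumes "c \<in> X_space a E" "(endpoint c, z) \<in> E"
  shows "endpoint (extend E c z) = z"
  using assms(1)
  by (rule X_spaceE) (use assms(2) in \<open>simp add: extend_e_class endpoint_e_class e_chain_append_single\<close>)

lemma extend_endpoint:
  assumes "c \<in> X_space a E" "(endpoint c, endpoint c) \<in> E"
  shows "extend E c (endpoint c) = c"
  using assms(1)
  by (rule X_spaceE) (use assms(2) in \<open>simp add: extend_e_class e_class_repeat_last\<close>)

lemma extend_extend:
  assumes "c \<in> X_space a E" "(endpoint c, z) \<in> E" "(z, w) \<in> E" "(endpoint c, w) \<in> E"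
  shows "extend E (extend E c z) w = extend E c w"
  using assms(1)
proof (rule X_spaceE)
  fix \<alpha> assume \<alpha>: "c = e_class E \<alpha>" "e_chain E \<alpha>" "endpoint c = last \<alpha>"
  then have "extend E (extend E c z) w = e_class E ((\<alpha> @ [z]) @ [w])"
    using assms by (simp add: extend_e_class e_chain_append_single del: append_assoc)
  also have "\<dots> = extend E c w"
    using \<alpha> assms by (simp add: extend_e_class e_class_drop_middle)
  finally show ?thesis .
qed

text \<open>
  Two chains \<open>xs @ [y]\<close> and \<open>xs @ [z]\<close> differing in the last point only are, up to homotopy, a
  chain and its continuation: the point \<open>y\<close> can be inserted into \<open>xs @ [z]\<close> before \<open>z\<close>.
\<close>

lemma star_ent_iff:
  fixes E :: "('a :: uniform_space \<times> 'a) set"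
  assumes E: "E \<in> entourages UNIV uniformity" and "D \<subseteq> E"
  shows "(c, d) \<in> star_ent a E D \<longleftrightarrow>
    c \<in> X_space a E \<and> (endpoint c, endpoint d) \<in> D \<and> extend E c (endpoint d) = d"
    (is "?L \<longleftrightarrow> ?R")
proof
  assume ?L
  then obtain xs y z where *: "c = e_class E (xs @ [y])" "d = e_class E (xs @ [z])"
    "xs \<noteq> []" "hd xs = a" "e_chain E (xs @ [y])" "e_chain E (xs @ [z])" "(y, z) \<in> D"
    by (auto simp: star_ent_def)
  have ends: "endpoint c = y" "endpoint d = z"
    using * by (simp_all add: endpoint_e_class)
  have "c \<in> X_space a E"
    using * by (auto simp: X_space_def intro!: exI[of _ "xs @ [y]"])
  moreover have "extend E c z = d"
    using * \<open>D \<subseteq> E\<close> e_chain_append_singleD[OF *(5,3)] e_chain_append_singleD[OF *(6,3)]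
    by (auto simp: extend_e_class e_class_drop_middle)
  ultimately show ?R using * ends by simp
next
  assume R: ?R
  then obtain \<alpha> where \<alpha>: "c = e_class E \<alpha>" "e_chain E \<alpha>" "hd \<alpha> = a" "endpoint c = last \<alpha>"
    by (blast elim: X_spaceE)
  define z where "z = endpoint d"
  have z: "(last \<alpha>, z) \<in> D" "d = extend E c z" using R \<alpha> z_def by auto
  then have "c = e_class E (\<alpha> @ [last \<alpha>])" "d = e_class E (\<alpha> @ [z])"
    using \<alpha> \<open>D \<subseteq> E\<close> entourage_refl[OF E] by (auto simp: e_class_repeat_last extend_e_class)
  moreover have "e_chain E (\<alpha> @ [last \<alpha>])" "e_chain E (\<alpha> @ [z])"
    using \<alpha> z \<open>D \<subseteq> E\<close> entourage_refl[OF E] by (auto simp: e_chain_append_single)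
  moreover have "\<alpha> \<noteq> []" using \<alpha> by (simp add: e_chain_def)
  ultimately show ?L using \<alpha>(3) z(1) unfolding star_ent_def by blast
qed

lemma sym_star_ent: "sym D \<Longrightarrow> sym (star_ent a E D)"
  unfolding sym_def star_ent_def by blast

lemma X_bond_star_ent:
  assumes "D \<subseteq> E" "(c, d) \<in> star_ent a D F"
  shows "(X_bond E c, X_bond E d) \<in> star_ent a E F"
proof -
  obtain xs y z where *: "c = e_class D (xs @ [y])" "d = e_class D (xs @ [z])"
    "xs \<noteq> []" "hd xs = a" "e_chain D (xs @ [y])" "e_chain D (xs @ [z])" "(y, z) \<in> F"
    using assms(2) by (auto simp: star_ent_def)
  have "e_chain D \<gamma> \<Longrightarrow> e_chain E \<gamma>" for \<gamma>
    unfolding e_chain_def using assms(1) by (auto intro: successively_mono)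
  then show ?thesis
    using * assms(1) unfolding star_ent_def by (auto simp: X_bond_e_class)
qed

section \<open>The uniformity of the inverse limit\<close>

lemma X_tilde_in_X_space:
  "f \<in> X_tilde a \<Longrightarrow> E \<in> entourages UNIV uniformity \<Longrightarrow> f E \<in> X_space a E"
  by (auto simp: X_tilde_def)

lemma X_tilde_bond:
  "f \<in> X_tilde a \<Longrightarrow> D \<in> entourages UNIV uniformity \<Longrightarrow> E \<in> entourages UNIV uniformity \<Longrightarrow>
    D \<subseteq> E \<Longrightarrow> X_bond E (f D) = f E"
  by (auto simp: X_tilde_def)

lemma X_tilde_star_ent_mono:
  assumes "f \<in> X_tilde a" "g \<in> X_tilde a" "D \<in> entourages UNIV uniformity"
    "E \<in> entourages UNIV uniformity" "D \<subseteq> E" "F \<subseteq> F'" "(f D, g D) \<in> star_ent a D F"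
  shows "(f E, g E) \<in> star_ent a E F'"
proof -
  have "(X_bond E (f D), X_bond E (g D)) \<in> star_ent a E F"
    by (rule X_bond_star_ent[OF assms(5,7)])
  then have "(f E, g E) \<in> star_ent a E F"
    using assms by (simp add: X_tilde_bond)
  then show ?thesis using \<open>F \<subseteq> F'\<close> by (auto simp: star_ent_def)
qed

text \<open>
  Subbasic entourages of the limit are given by pairs \<open>D \<subseteq> E\<close>. A single index suffices, because
  the bonding map from level \<open>D\<close> sends \<open>star_ent a D D\<close> into \<open>star_ent a E D\<close>; so the smaller
  entourage may be used as the level as well.
\<close>

lemma eventually_X_tilde_unif:
  fixes a :: "'a :: uniform_space"
  shows "eventually P (X_tilde_unif a) \<longleftrightarrow>
    (\<exists>E\<in>entourages UNIV uniformity. \<forall>f\<in>X_tilde a. \<forall>g\<in>X_tilde a.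
      (f E, g E) \<in> star_ent a E E \<longrightarrow> P (f, g))"
proof -
  let ?I = "entourages UNIV (uniformity :: ('a \<times> 'a) filter)"
  let ?B = "\<lambda>E. {(f, g). f \<in> X_tilde a \<and> g \<in> X_tilde a \<and> (f E, g E) \<in> star_ent a E E}"
  have mono: "?B D \<subseteq> ?B E" if "D \<in> ?I" "E \<in> ?I" "D \<subseteq> E" for D E
    using X_tilde_star_ent_mono[OF _ _ that that(3)] by auto
  have "X_tilde_unif a = (INF E\<in>?I. principal (?B E))"
  proof (rule antisym)
    show "X_tilde_unif a \<le> (INF E\<in>?I. principal (?B E))"
    proof (rule INF_greatest)
      fix E assume E: "E \<in> ?I"
      have "eventually (\<lambda>p. p \<in> star_ent a E E) (X_unif a E)"
        using E by (auto simp: eventually_X_unif)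
      then have "eventually (\<lambda>p. (fst p E, snd p E) \<in> star_ent a E E)
          (filtercomap (map_prod (X_tilde_proj E) (X_tilde_proj E)) (X_unif a E))"
        by (auto simp: eventually_filtercomap X_tilde_proj_def map_prod_def case_prod_beta
            intro!: exI[of _ "\<lambda>p. p \<in> star_ent a E E"])
      then have "eventually (\<lambda>p. (fst p E, snd p E) \<in> star_ent a E E)
          (INF E\<in>?I. filtercomap (map_prod (X_tilde_proj E) (X_tilde_proj E)) (X_unif a E))"
        by (rule filter_leD[OF INF_lower[OF E]])
      then show "X_tilde_unif a \<le> principal (?B E)"
        unfolding X_tilde_unif_def le_principal inf_commute[of "principal _"] eventually_inf_principal
        by (rule eventually_mono) auto
    qed
    show "(INF E\<in>?I. principal (?B E)) \<le> X_tilde_unif a"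
      unfolding X_tilde_unif_def
    proof (rule inf_greatest)
      have "(INF E\<in>?I. principal (?B E)) \<le> principal (?B UNIV)"
        by (rule INF_lower[OF UNIV_entourage])
      also have "\<dots> \<le> principal (X_tilde a \<times> X_tilde a)" by auto
      finally show "(INF E\<in>?I. principal (?B E)) \<le> principal (X_tilde a \<times> X_tilde a)" .
      show "(INF E\<in>?I. principal (?B E)) \<le>
          (INF E\<in>?I. filtercomap (map_prod (X_tilde_proj E) (X_tilde_proj E)) (X_unif a E))"
      proof (intro INF_greatest filter_leI)
        fix E Q
        assume E: "E \<in> ?I" and
          "eventually Q (filtercomap (map_prod (X_tilde_proj E) (X_tilde_proj E)) (X_unif a E))"
        then obtain R where R: "eventually R (X_unif a E)"
          "\<And>p. R (map_prod (X_tilde_proj E) (X_tilde_proj E) p) \<Longrightarrow> Q p"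
          unfolding eventually_filtercomap by blast
        from R(1) obtain D where D: "D \<in> ?I" "D \<subseteq> E" "\<And>p. p \<in> star_ent a E D \<Longrightarrow> R p"
          unfolding eventually_X_unif[OF E] by blast
        have "Q p" if "p \<in> ?B D" for p
        proof -
          obtain f g where p: "p = (f, g)" by fastforce
          with that have "(f E, g E) \<in> star_ent a E D"
            using X_tilde_star_ent_mono[OF _ _ D(1) E D(2) order.refl] by blast
          then show ?thesis
            using D(3) R(2)[of p] p by (simp add: X_tilde_proj_def)
        qed
        then have "eventually Q (principal (?B D))"
          by (simp add: eventually_principal)
        then show "eventually Q (INF E\<in>?I. principal (?B E))"
          by (rule filter_leD[OF INF_lower[OF D(1)]])
      qed
    qed
  qed
  moreover have "eventually P (INF E\<in>?I. principal (?B E)) \<longleftrightarrow>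
      (\<exists>E\<in>?I. eventually P (principal (?B E)))"
  proof (rule eventually_INF_base)
    show "?I \<noteq> {}" using UNIV_entourage by blast
    fix D E assume DE: "D \<in> ?I" "E \<in> ?I"
    show "\<exists>F\<in>?I. principal (?B F) \<le> inf (principal (?B D)) (principal (?B E))"
    proof
      show *: "D \<inter> E \<in> ?I" using DE by (rule entourages_Int)
      show "principal (?B (D \<inter> E)) \<le> inf (principal (?B D)) (principal (?B E))"
        using mono[OF * DE(1)] mono[OF * DE(2)] by simp
    qed
  qed
  ultimately show ?thesis
    by (auto simp: eventually_principal)
qed

lemma eventually_X_tilde_unif_star_ent:
  fixes a :: "'a :: uniform_space"
  assumes "E \<in> entourages UNIV uniformity" "D \<in> entourages UNIV uniformity" "D \<subseteq> E"
    and "\<And>f g. f \<in> X_tilde a \<Longrightarrow> g \<in> X_tilde a \<Longrightarrow> (f E, g E) \<in> star_ent a E D \<Longrightarrow> P (f, g)"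
  shows "eventually P (X_tilde_unif a)"
  unfolding eventually_X_tilde_unif
proof (intro bexI[OF _ assms(2)] ballI impI)
  fix f g assume "f \<in> X_tilde a" "g \<in> X_tilde a" "(f D, g D) \<in> star_ent a D D"
  then show "P (f, g)"
    by (intro assms(4) X_tilde_star_ent_mono[OF _ _ assms(2,1,3) order.refl])
qed

section \<open>Sheets over small open sets\<close>

text \<open>
  The preimage in the limit of the sheet over \<open>V\<close> through \<open>f E\<close>. Working in the limit directly
  avoids a separate treatment of the uniformity of \<open>X_space a E\<close>.
\<close>

definition sheet ::
    "'a :: uniform_space \<Rightarrow> ('a \<times> 'a) set \<Rightarrow> (('a \<times> 'a) set \<Rightarrow> 'a list set) \<Rightarrow> 'a set \<Rightarrow>
      (('a \<times> 'a) set \<Rightarrow> 'a list set) set" where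
  "sheet a E f V = {g \<in> X_tilde a. endpoint (g E) \<in> V \<and> extend E (f E) (endpoint (g E)) = g E}"

context
  fixes a :: "'a :: uniform_space" and E :: "('a \<times> 'a) set" and V :: "'a set"
  assumes E: "E \<in> entourages UNIV uniformity" and V: "V \<times> V \<subseteq> E"
begin

lemma sheet_self:
  assumes "f \<in> X_tilde a" "endpoint (f E) \<in> V"
  shows "f \<in> sheet a E f V"
  using assms extend_endpoint[OF X_tilde_in_X_space[OF assms(1) E]] entourage_refl[OF E]
  by (simp add: sheet_def)

lemma sheet_subset_ball:
  assumes "f \<in> X_tilde a" "endpoint (f E) \<in> V" "g \<in> sheet a E f V"
  shows "(f E, g E) \<in> star_ent a E E"
  using assms V X_tilde_in_X_space[OF assms(1) E]
  by (auto simp: sheet_def star_ent_iff[OF E])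

text \<open>
  Inside \<open>V\<close> all steps are \<open>E\<close>-small, so continuing first to the endpoint of \<open>g E\<close> and then to
  that of \<open>h E\<close> amounts to a single step. This gives both openness of the sheets and their
  disjointness.
\<close>

lemma sheet_step:
  assumes f: "f \<in> X_tilde a" "endpoint (f E) \<in> V" and g: "g \<in> sheet a E f V"
    and h: "h \<in> X_tilde a" "endpoint (h E) \<in> V" "extend E (g E) (endpoint (h E)) = h E"
  shows "h \<in> sheet a E f V"
proof -
  have "extend E (f E) (endpoint (h E)) =
      extend E (extend E (f E) (endpoint (g E))) (endpoint (h E))"
    using f(2) g h(2) V
    by (intro extend_extend[OF X_tilde_in_X_space[OF f(1) E], symmetric]) (auto simp: sheet_def)
  also have "\<dots> = h E"
    using g h(3) by (simp add: sheet_def)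
  finally show ?thesis using h by (simp add: sheet_def)
qed

lemma sheet_sym:
  assumes f: "f \<in> X_tilde a" "endpoint (f E) \<in> V" and g: "g \<in> sheet a E f V"
  shows "f \<in> sheet a E g V"
proof -
  have "sym (star_ent a E E)"
    using E by (auto simp: entourages_def intro: sym_star_ent)
  then have "(g E, f E) \<in> star_ent a E E"
    using sheet_subset_ball[OF assms] by (rule symD)
  then show ?thesis
    using f by (simp add: star_ent_iff[OF E] sheet_def)
qed

lemma sheet_eq:
  assumes f: "f \<in> X_tilde a" "endpoint (f E) \<in> V" and g: "g \<in> sheet a E f V"
  shows "sheet a E f V = sheet a E g V"
proof -
  have g': "g \<in> X_tilde a" "endpoint (g E) \<in> V" using g by (auto simp: sheet_def)
  have "h \<in> sheet a E f V" if "h \<in> sheet a E g V" for h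
    by (rule sheet_step[OF f g]) (use that in \<open>auto simp: sheet_def\<close>)
  moreover have "h \<in> sheet a E g V" if "h \<in> sheet a E f V" for h
    by (rule sheet_step[OF g' sheet_sym[OF f g]]) (use that in \<open>auto simp: sheet_def\<close>)
  ultimately show ?thesis by blast
qed

lemma unif_open_sheet:
  assumes f: "f \<in> X_tilde a" "endpoint (f E) \<in> V" and "open V"
  shows "unif_open (X_tilde a) (X_tilde_unif a) (sheet a E f V)"
  unfolding unif_open_def
proof (intro conjI ballI)
  show "sheet a E f V \<subseteq> X_tilde a" by (auto simp: sheet_def)
  fix g assume g: "g \<in> sheet a E f V"
  then have "endpoint (g E) \<in> V" by (simp add: sheet_def)
  with \<open>open V\<close> have "eventually (\<lambda>(x, y). x = endpoint (g E) \<longrightarrow> y \<in> V) uniformity"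
    by (simp add: open_uniformity)
  from eventually_uniformity_imp_entourage[OF this] obtain D where D:
    "D \<in> entourages UNIV uniformity"
    "\<forall>p\<in>D. case p of (x, y) \<Rightarrow> x = endpoint (g E) \<longrightarrow> y \<in> V"
    by blast
  show "eventually (\<lambda>(x', y). x' = g \<longrightarrow> y \<in> sheet a E f V) (X_tilde_unif a)"
  proof (rule eventually_X_tilde_unif_star_ent[OF E entourages_Int[OF D(1) E]])
    fix x h
    assume h: "h \<in> X_tilde a" and "(x E, h E) \<in> star_ent a E (D \<inter> E)"
    then have xh: "(endpoint (x E), endpoint (h E)) \<in> D"
      "extend E (x E) (endpoint (h E)) = h E"
      using star_ent_iff[OF E, of "D \<inter> E"] by auto
    show "case (x, h) of (x', y) \<Rightarrow> x' = g \<longrightarrow> y \<in> sheet a E f V"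
      using sheet_step[OF f g h] xh D(2) by auto
  qed simp
qed

end

section \<open>Dimension of the inverse limit\<close>

lemma uniform_open_cover_sheets:
  fixes a :: "'a :: uniform_space"
  assumes E: "E \<in> entourages UNIV uniformity"
    and cov: "uniform_open_cover UNIV uniformity \<V>"
    and small: "\<And>V. V \<in> \<V> \<Longrightarrow> V \<times> V \<subseteq> E"
  shows "uniform_open_cover (X_tilde a) (X_tilde_unif a)
    {sheet a E f V |f V. f \<in> X_tilde a \<and> V \<in> \<V> \<and> endpoint (f E) \<in> V}"
    (is "uniform_open_cover _ _ ?W")
proof -
  obtain G where G: "G \<in> entourages UNIV uniformity"
    "\<forall>x. \<exists>V\<in>\<V>. G `` {x} \<subseteq> V"
    using cov unfolding uniform_open_cover_def refines_balls_iff by auto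
  define H where "H = {(f, g). f \<in> X_tilde a \<and> g \<in> X_tilde a \<and> (f E, g E) \<in> star_ent a E (G \<inter> E)}"
  have GE: "G \<inter> E \<in> entourages UNIV uniformity" by (rule entourages_Int[OF G(1) E])
  have "sym (star_ent a E (G \<inter> E))"
    using GE by (intro sym_star_ent) (simp add: entourages_def)
  then have "sym H"
    unfolding H_def by (auto intro!: symI dest: symD)
  moreover have "eventually (\<lambda>p. p \<in> H) (X_tilde_unif a)"
    by (rule eventually_X_tilde_unif_star_ent[OF E GE]) (auto simp: H_def)
  ultimately have H: "H \<in> entourages (X_tilde a) (X_tilde_unif a)"
    by (auto simp: entourages_def H_def)
  have ball: "\<exists>V\<in>\<V>. endpoint (f E) \<in> V \<and> H `` {f} \<subseteq> sheet a E f V" for f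
  proof -
    obtain V where V: "V \<in> \<V>" "G `` {endpoint (f E)} \<subseteq> V"
      using G(2) by blast
    moreover have "endpoint (f E) \<in> V" using V entourage_refl[OF G(1)] by blast
    moreover have "H `` {f} \<subseteq> sheet a E f V"
    proof
      fix h assume "h \<in> H `` {f}"
      then have "h \<in> X_tilde a" "(f E, h E) \<in> star_ent a E (G \<inter> E)" by (auto simp: H_def)
      then show "h \<in> sheet a E f V"
        using V(2) by (auto simp: star_ent_iff[OF E] sheet_def)
    qed
    ultimately show ?thesis by blast
  qed
  have "refines {H `` {f} |f. f \<in> X_tilde a} ?W"
    unfolding refines_balls_iff
  proof
    fix f assume f: "f \<in> X_tilde a"
    obtain V where V: "V \<in> \<V>" "endpoint (f E) \<in> V" "H `` {f} \<subseteq> sheet a E f V"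
      using ball by blast
    then have "sheet a E f V \<in> ?W" using f by blast
    then show "\<exists>W\<in>?W. H `` {f} \<subseteq> W" using V(3) by (rule rev_bexI)
  qed
  moreover have "\<Union>?W = X_tilde a"
  proof
    show "\<Union>?W \<subseteq> X_tilde a" by (auto simp: sheet_def)
    show "X_tilde a \<subseteq> \<Union>?W"
    proof
      fix f assume f: "f \<in> X_tilde a"
      obtain V where V: "V \<in> \<V>" "endpoint (f E) \<in> V" using ball by blast
      have "f \<in> sheet a E f V" by (rule sheet_self[OF E small[OF V(1)] f V(2)])
      moreover have "sheet a E f V \<in> ?W" using f V by blast
      ultimately show "f \<in> \<Union>?W" by (rule UnionI[rotated])
    qed
  qed
  moreover have "\<forall>W\<in>?W. unif_open (X_tilde a) (X_tilde_unif a) W"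
  proof
    fix W assume "W \<in> ?W"
    then obtain f V where W: "W = sheet a E f V" "f \<in> X_tilde a" "V \<in> \<V>" "endpoint (f E) \<in> V"
      by blast
    have "open V"
      using cov W(3) by (auto simp: uniform_open_cover_def unif_open_UNIV)
    then show "unif_open (X_tilde a) (X_tilde_unif a) W"
      unfolding W(1) by (rule unif_open_sheet[OF E small[OF W(3)] W(2,4)])
  qed
  ultimately show ?thesis using H unfolding uniform_open_cover_def by blast
qed

theorem theorem88:
  fixes a :: "'a :: uniform_space" and n :: nat
  assumes "coverable a"
    and "udim_le (UNIV :: 'a set) uniformity n"
  shows "udim_le (X_tilde a) (X_tilde_unif a) n"
  unfolding udim_le_def
proof (intro allI impI)
  fix \<U> assume \<U>: "uniform_open_cover (X_tilde a) (X_tilde_unif a) \<U>"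
  then obtain F where F: "eventually (\<lambda>p. p \<in> F) (X_tilde_unif a)"
    "\<forall>f\<in>X_tilde a. \<exists>U\<in>\<U>. F `` {f} \<subseteq> U"
    unfolding uniform_open_cover_def refines_balls_iff entourages_def by blast
  from F(1) obtain E where E: "E \<in> entourages UNIV uniformity"
    "\<And>f g. f \<in> X_tilde a \<Longrightarrow> g \<in> X_tilde a \<Longrightarrow> (f E, g E) \<in> star_ent a E E \<Longrightarrow> (f, g) \<in> F"
    unfolding eventually_X_tilde_unif by blast
  obtain \<V> where \<V>: "uniform_open_cover UNIV uniformity \<V>" "refines \<V> {V. open V \<and> V \<times> V \<subseteq> E}"
    "\<And>x. finite {V \<in> \<V>. x \<in> V} \<and> card {V \<in> \<V>. x \<in> V} \<le> n + 1"
    using assms(2) uniform_open_cover_small_sets[OF E(1)] unfolding udim_le_def by blast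
  have small: "V \<times> V \<subseteq> E" if "V \<in> \<V>" for V
    using that \<V>(2) unfolding refines_def by blast
  let ?W = "{sheet a E f V |f V. f \<in> X_tilde a \<and> V \<in> \<V> \<and> endpoint (f E) \<in> V}"
  have "uniform_open_cover (X_tilde a) (X_tilde_unif a) ?W"
    by (rule uniform_open_cover_sheets[OF E(1) \<V>(1) small])
  moreover have "refines ?W \<U>"
    unfolding refines_def
  proof
    fix W assume "W \<in> ?W"
    then obtain f V where W: "W = sheet a E f V" "f \<in> X_tilde a" "V \<in> \<V>" "endpoint (f E) \<in> V"
      by blast
    have "W \<subseteq> F `` {f}"
    proof
      fix g assume "g \<in> W"
      then have "g \<in> sheet a E f V" "g \<in> X_tilde a" using W(1) by (auto simp: sheet_def)
      then have "(f, g) \<in> F"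
        by (intro E(2) W(2) sheet_subset_ball[OF E(1) small[OF W(3)] W(2,4)])
      then show "g \<in> F `` {f}" by blast
    qed
    moreover obtain U where "U \<in> \<U>" "F `` {f} \<subseteq> U" using F(2) W(2) by blast
    ultimately show "\<exists>U\<in>\<U>. W \<subseteq> U" by blast
  qed
  moreover have "finite {W \<in> ?W. g \<in> W} \<and> card {W \<in> ?W. g \<in> W} \<le> n + 1" if "g \<in> X_tilde a" for g
  proof -
    let ?N = "{V \<in> \<V>. endpoint (g E) \<in> V}"
    \<comment> \<open>The sheets through \<open>g\<close> are determined by their base sets.\<close>
    have sub: "{W \<in> ?W. g \<in> W} \<subseteq> sheet a E g ` ?N"
    proof
      fix W assume "W \<in> {W \<in> ?W. g \<in> W}"
      then obtain f V where W: "W = sheet a E f V" "f \<in> X_tilde a" "V \<in> \<V>" "endpoint (f E) \<in> V"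
        "g \<in> sheet a E f V"
        by blast
      then have "W = sheet a E g V" using sheet_eq[OF E(1) small] by blast
      moreover have "V \<in> ?N" using W by (simp add: sheet_def)
      ultimately show "W \<in> sheet a E g ` ?N" by blast
    qed
    have fin: "finite ?N" "card ?N \<le> n + 1" using \<V>(3) by blast+
    have "card {W \<in> ?W. g \<in> W} \<le> card (sheet a E g ` ?N)"
      using fin(1) sub by (intro card_mono) auto
    also have "\<dots> \<le> card ?N" using fin(1) by (rule card_image_le)
    finally show ?thesis using fin finite_subset[OF sub] by auto
  qed
  ultimately show "\<exists>\<W>. uniform_open_cover (X_tilde a) (X_tilde_unif a) \<W> \<and> refines \<W> \<U> \<and>
      (\<forall>x\<in>X_tilde a. finite {W \<in> \<W>. x \<in> W} \<and> card {W \<in> \<W>. x \<in> W} \<le> n + 1)"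
    by (intro exI[of _ ?W]) blast
qed

end
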